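(* Let $(W,S)$ be a Coxeter system with $S$ finite, let $n=|S|$, and let $c\in W$ be a Coxeter element. There exists no quadruple $\{a,b,x,y\}$ of pairwise distinct elements of $[1,c]_T$ such that (i) $\ell_T(a)=\ell_T(b)=k$ and $\ell_T(x)=\ell_T(y)=k+1$ for some $1\leq k\leq n-2$, and (ii) $a\leq_T x$, $a\leq_T y$, $b\leq_T x$, $b\leq_T y$.
   Context: $T=\bigcup_{w\in W} wSw^{-1}$ is the set of reflections of $W$. The reflection length $\ell_T(w)$ is the smallest $k\ge 0$ such that $w$ is a product of $k$ elements of $T$. The absolute order is the partial order on $W$ defined by $u\leq_T v \iff \ell_T(u)+\ell_T(u^{-1}v)=\ell_T(v)$. A Coxeter element is a product of all the elements of $S$, each occurring exactly once, in some order. $[1,c]_T=\{x\in W\mid x\leq_T c\}$. *)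

theory Defs
  imports "HOL-Algebra.Generated_Groups"
begin

section \<open>Group presentations\<close>

text \<open>
  A letter is a generator together with a sign: \<open>(s, True)\<close> stands for \<open>s\<close> and \<open>(s, False)\<close>
  for its formal inverse.
\<close>

type_synonym 'a signed_word = "('a \<times> bool) list"

text \<open>
  Equality of signed words in the abstract group with generators \<open>S\<close> and relators \<open>R\<close>:
  the congruence generated by free cancellation and by deletion of relators.
\<close>

inductive presentation_eq :: "'a set \<Rightarrow> 'a signed_word set \<Rightarrow> 'a signed_word \<Rightarrow> 'a signed_word \<Rightarrow> bool"
  for S :: "'a set" and R :: "'a signed_word set" where
  refl: "presentation_eq S R u u"
| sym: "presentation_eq S R u v \<Longrightarrow> presentation_eq S R v u"
| trans: "presentation_eq S R u v \<Longrightarrow> presentation_eq S R v w \<Longrightarrow> presentation_eq S R u w"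
| cancel: "s \<in> S \<Longrightarrow> presentation_eq S R (u @ [(s, e), (s, \<not> e)] @ v) (u @ v)"
| relator: "r \<in> R \<Longrightarrow> presentation_eq S R (u @ r @ v) (u @ v)"

definition list_prod :: "('a, 'b) monoid_scheme \<Rightarrow> 'a list \<Rightarrow> 'a" where
  "list_prod G ws = foldr (\<otimes>\<^bsub>G\<^esub>) ws \<one>\<^bsub>G\<^esub>"

definition eval_word :: "('a, 'b) monoid_scheme \<Rightarrow> 'a signed_word \<Rightarrow> 'a" where
  "eval_word G w = list_prod G (map (\<lambda>(s, e). if e then s else inv\<^bsub>G\<^esub> s) w)"

text \<open>
  The canonical map from the abstract group with generators \<open>S\<close> and relators \<open>R\<close> to \<open>G\<close> is
  well defined and an isomorphism: it is onto because \<open>S\<close> generates \<open>G\<close>, and the last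
  conjunct says that it is well defined and injective.
\<close>

definition presented_by :: "('a, 'b) monoid_scheme \<Rightarrow> 'a set \<Rightarrow> 'a signed_word set \<Rightarrow> bool" where
  "presented_by G S R \<longleftrightarrow>
     group G \<and> S \<subseteq> carrier G \<and> R \<subseteq> lists (S \<times> UNIV) \<and> generate G S = carrier G \<and>
     (\<forall>u \<in> lists (S \<times> UNIV). \<forall>v \<in> lists (S \<times> UNIV).
        eval_word G u = eval_word G v \<longleftrightarrow> presentation_eq S R u v)"

section \<open>Coxeter systems\<close>

text \<open>
  The value \<open>0\<close> encodes the entry \<open>\<infinity>\<close> of a Coxeter matrix; the corresponding relator below
  is the empty word, that is, no relation is imposed.
\<close>

definition coxeter_matrix :: "'a set \<Rightarrow> ('a \<Rightarrow> 'a \<Rightarrow> nat) \<Rightarrow> bool" where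
  "coxeter_matrix S m \<longleftrightarrow>
     (\<forall>s\<in>S. m s s = 1) \<and>
     (\<forall>s\<in>S. \<forall>t\<in>S. s \<noteq> t \<longrightarrow> m s t = m t s \<and> (m s t = 0 \<or> m s t \<ge> 2))"

definition coxeter_relators :: "'a set \<Rightarrow> ('a \<Rightarrow> 'a \<Rightarrow> nat) \<Rightarrow> 'a signed_word set" where
  "coxeter_relators S m =
     {concat (replicate (m s t) [(s, True), (t, True)]) | s t. s \<in> S \<and> t \<in> S}"

definition coxeter_system :: "('a, 'b) monoid_scheme \<Rightarrow> 'a set \<Rightarrow> bool" where
  "coxeter_system W S \<longleftrightarrow>
     (\<exists>m. coxeter_matrix S m \<and> presented_by W S (coxeter_relators S m))"

section \<open>Reflection length, absolute order and Coxeter elements\<close>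

definition reflections :: "('a, 'b) monoid_scheme \<Rightarrow> 'a set \<Rightarrow> 'a set" where
  "reflections W S =
     {w \<otimes>\<^bsub>W\<^esub> s \<otimes>\<^bsub>W\<^esub> inv\<^bsub>W\<^esub> w | w s. w \<in> carrier W \<and> s \<in> S}"

definition reflection_length :: "('a, 'b) monoid_scheme \<Rightarrow> 'a set \<Rightarrow> 'a \<Rightarrow> nat" where
  "reflection_length W S w =
     (LEAST k. \<exists>ts. set ts \<subseteq> reflections W S \<and> length ts = k \<and> list_prod W ts = w)"

definition absolute_le :: "('a, 'b) monoid_scheme \<Rightarrow> 'a set \<Rightarrow> 'a \<Rightarrow> 'a \<Rightarrow> bool" where
  "absolute_le W S u v \<longleftrightarrow>
     u \<in> carrier W \<and> v \<in> carrier W \<and>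
     reflection_length W S u + reflection_length W S (inv\<^bsub>W\<^esub> u \<otimes>\<^bsub>W\<^esub> v) = reflection_length W S v"

definition coxeter_element :: "('a, 'b) monoid_scheme \<Rightarrow> 'a set \<Rightarrow> 'a \<Rightarrow> bool" where
  "coxeter_element W S c \<longleftrightarrow> (\<exists>ss. distinct ss \<and> set ss = S \<and> list_prod W ss = c)"

definition absolute_interval :: "('a, 'b) monoid_scheme \<Rightarrow> 'a set \<Rightarrow> 'a \<Rightarrow> 'a set" where
  "absolute_interval W S c = {x \<in> carrier W. absolute_le W S x c}"

end

theory Submission
  imports Defs "HOL-Analysis.Product_Vector" "HOL-Library.Function_Algebras"
begin

text \<open>
  The idea is to attach to every element \<open>x\<close> of the interval below \<open>c\<close> a linear subspace, of
  dimension the reflection length of \<open>x\<close>, and to show that this subspace determines \<open>x\<close>. Then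
  the claim is about subspaces: if \<open>A \<noteq> A'\<close> both have dimension \<open>k\<close> and both lie in \<open>X\<close> and in
  \<open>Y\<close>, of dimension \<open>k + 1\<close>, then \<open>X = A + A' = Y\<close>.

  The group acts by reflections on \<open>V \<oplus> V*\<close>, where \<open>V\<close> has the simple roots as basis.
  Its bilinear form extends the usual form on \<open>V\<close> by the pairing of \<open>V\<close> with \<open>V*\<close>, so that
  every linear functional on \<open>V\<close> is a product with some vector, even if the form on \<open>V\<close> is
  degenerate. A reflection moves vectors only along its root, which lies in \<open>V\<close>. The subspace attached to
  \<open>x\<close> is the moved space, the set of all \<open>z - x z\<close>. It lies in the span of the roots of any
  factorization of \<open>x\<close> into reflections.

  Thanks to the summand \<open>V*\<close>, a Coxeter element \<open>c\<close> moves onto all of \<open>V\<close>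
  (\<open>moved_space_coxeter_element\<close>). Hence a factorization of \<open>c\<close> into reflections has at least
  \<open>n\<close> factors, and the roots of one with \<open>n\<close> factors form a basis of \<open>V\<close>. A reduced factorization of \<open>x\<close> below
  \<open>c\<close> extends to a reduced one of \<open>c\<close>, say \<open>c = x u\<close>; the roots of \<open>x\<close> and of \<open>u\<close> together are
  independent. If \<open>z - c z\<close> lies in the span of the roots of \<open>x\<close>, then the component \<open>z - u z\<close>
  in the complementary span vanishes, so \<open>x z = c z\<close> (\<open>foldr_reflect_agree_on_span\<close>). It
  follows that the moved space of \<open>x\<close> is the full span of its roots, and that \<open>x\<close> agrees with
  \<open>c\<close> on all vectors which \<open>c\<close> moves into that space. On the orthogonal complement of that
  space \<open>x\<close> is the identity. These vectors together span everything, so the moved space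
  determines the action of \<open>x\<close> (\<open>foldr_reflect_determined_by_span\<close>). By the theorem of Tits
  that the representation is faithful (\<open>action_faithful\<close>), it determines \<open>x\<close>.
\<close>

section \<open>Products of reflections in a vector space with a symmetric form\<close>

text \<open>
  The set \<open>S\<close> is a subset of an arbitrary type, so the representation space is built from
  real functions on that type.
\<close>
instantiation "fun" :: (type, real_vector) real_vector
begin
definition scaleR_fun :: "real \<Rightarrow> ('a \<Rightarrow> 'b) \<Rightarrow> 'a \<Rightarrow> 'b" where
  "scaleR_fun r f = (\<lambda>x. r *\<^sub>R f x)"
instance
  by standard (simp_all add: scaleR_fun_def fun_eq_iff scaleR_add_right scaleR_add_left)
end

lemma independent_Un_span_disjoint:
  fixes v :: "'v::real_vector"
  assumes "independent (X \<union> Y)" "X \<inter> Y = {}" "v \<in> span X" "v \<in> span Y"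
  shows "v = 0"
proof -
  have "representation (X \<union> Y) v = representation X v" "representation (X \<union> Y) v = representation Y v"
    using assms by (auto intro: representation_extend)
  then have "{b. representation X v b \<noteq> 0} = {}"
    using representation_ne_zero[of X v] representation_ne_zero[of Y v] assms(2) by auto
  moreover have "(\<Sum>b | representation X v b \<noteq> 0. representation X v b *\<^sub>R b) = v"
    using assms(3) independent_mono[OF assms(1), of X] by (intro sum_nonzero_representation_eq) auto
  ultimately show ?thesis by simp
qed

text \<open>
  This is applied to the roots of a factorization of a Coxeter element: they span the space
  generated by the simple roots, and there are not more of them.
\<close>
lemma spanning_list_of_minimal_length:
  fixes \<beta>s :: "'v::real_vector list"
  assumes "independent X" "X \<subseteq> span (set \<beta>s)" "length \<beta>s \<le> card X"
  shows "distinct \<beta>s" "independent (set \<beta>s)" "span (set \<beta>s) = span X"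
proof -
  have X: "finite X" "card X \<le> card (set \<beta>s)"
    using independent_span_bound[of "set \<beta>s" X] assms(1,2) by simp_all
  have le: "card (set \<beta>s) \<le> card X"
    using card_length[of \<beta>s] assms(3) by linarith
  then show "distinct \<beta>s"
    using X card_length[of \<beta>s] assms(3) by (intro card_distinct) linarith
  show "independent (set \<beta>s)"
  proof
    assume "dependent (set \<beta>s)"
    then obtain \<beta> where \<beta>: "\<beta> \<in> set \<beta>s" "\<beta> \<in> span (set \<beta>s - {\<beta>})" by (auto simp: dependent_def)
    then have "X \<subseteq> span (set \<beta>s - {\<beta>})"
      using assms(2) span_redundant[OF \<beta>(2)] by (simp add: insert_absorb)
    then have "card X \<le> card (set \<beta>s - {\<beta>})"
      using independent_span_bound[of "set \<beta>s - {\<beta>}" X] assms(1) by simp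
    also have "\<dots> < card (set \<beta>s)"
      using \<beta>(1) by (intro psubset_card_mono) auto
    finally show False using le by simp
  qed
  have "v \<in> span X" if v: "v \<in> span (set \<beta>s)" for v
  proof (rule ccontr)
    assume notin: "v \<notin> span X"
    then have "independent (insert v X)" using assms(1) by (rule independent_insertI)
    moreover have "insert v X \<subseteq> span (set \<beta>s)" using v assms(2) by simp
    ultimately have "card (insert v X) \<le> card (set \<beta>s)"
      using independent_span_bound[of "set \<beta>s"] by blast
    moreover have "v \<notin> X" using notin span_base by auto
    ultimately show False using le X(1) by simp
  qed
  moreover have "span X \<subseteq> span (set \<beta>s)"
    using assms(2) by (rule span_minimal) (rule subspace_span)
  ultimately show "span (set \<beta>s) = span X" by blast
qed

locale symmetric_form =
  fixes B :: "'v::real_vector \<Rightarrow> 'v \<Rightarrow> real"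
  assumes form_sym: "B x y = B y x"
    and form_add_left: "B (x + y) z = B x z + B y z"
    and form_scaleR_left: "B (r *\<^sub>R x) z = r * B x z"
begin

lemma form_add_right: "B x (y + z) = B x y + B x z"
  by (metis form_sym form_add_left)

lemma form_scaleR_right: "B x (r *\<^sub>R y) = r * B x y"
  by (metis form_sym form_scaleR_left)

lemma form_diff_left: "B (x - y) z = B x z - B y z"
  using form_add_left[of "x - y" y z] by simp

lemma form_diff_right: "B x (y - z) = B x y - B x z"
  by (metis form_sym form_diff_left)

lemma form_zero_right: "B x 0 = 0"
  using form_scaleR_right[of x 0 0] by simp

lemmas form_simps = form_add_left form_scaleR_left form_add_right form_scaleR_right
  form_diff_left form_diff_right

text \<open>
  This is the reflection in the hyperplane orthogonal to \<open>\<beta>\<close> when \<open>\<beta>\<close> is normalized by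
  \<open>B \<beta> \<beta> = 2\<close>; \<open>foldr reflect \<beta>s\<close> is a product of such maps whose last factor acts first.
\<close>
definition reflect :: "'v \<Rightarrow> 'v \<Rightarrow> 'v" where
  "reflect \<beta> z = z - B z \<beta> *\<^sub>R \<beta>"

lemma linear_reflect: "linear (reflect \<beta>)"
  by (rule linearI) (simp_all add: reflect_def form_simps algebra_simps)

lemma linear_foldr_reflect: "linear (foldr reflect \<beta>s)"
proof (induction \<beta>s)
  case Nil
  then show ?case by (simp add: id_def linear_ident)
next
  case (Cons \<beta> \<beta>s)
  then show ?case using linear_compose[OF Cons linear_reflect[of \<beta>]] by (simp add: comp_def)
qed

lemma reflect_reflect: "B \<beta> \<beta> = 2 \<Longrightarrow> reflect \<beta> (reflect \<beta> z) = z"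
  by (simp add: reflect_def form_simps algebra_simps)

lemma form_reflect_reflect: "B \<beta> \<beta> = 2 \<Longrightarrow> B (reflect \<beta> x) (reflect \<beta> y) = B x y"
  by (simp add: reflect_def form_simps algebra_simps form_sym[of \<beta> x] form_sym[of \<beta> y])

lemma foldr_reflect_moves_in_span: "z - foldr reflect \<beta>s z \<in> span (set \<beta>s)"
proof (induction \<beta>s)
  case Nil
  then show ?case by (simp add: span_zero)
next
  case (Cons \<beta> \<beta>s)
  have "z - foldr reflect \<beta>s z \<in> span (set (\<beta> # \<beta>s))"
    using Cons span_mono[of "set \<beta>s" "set (\<beta> # \<beta>s)"] by auto
  then have "(z - foldr reflect \<beta>s z) + B (foldr reflect \<beta>s z) \<beta> *\<^sub>R \<beta> \<in> span (set (\<beta> # \<beta>s))"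
    by (intro span_add span_scale) (auto intro: span_base)
  then show ?case by (simp add: reflect_def[of \<beta>] algebra_simps)
qed

lemma foldr_reflect_fixes_orthogonal:
  "(\<And>\<beta>. \<beta> \<in> set \<beta>s \<Longrightarrow> B u \<beta> = 0) \<Longrightarrow> foldr reflect \<beta>s u = u"
  by (induction \<beta>s) (simp_all add: reflect_def)

lemma orthogonal_span:
  assumes "\<And>\<beta>. \<beta> \<in> X \<Longrightarrow> B u \<beta> = 0" and "v \<in> span X"
  shows "B u v = 0"
  using assms(2)
  by (induction rule: span_induct_alt)
     (simp_all add: form_simps form_zero_right assms(1))

text \<open>
  The first reflection moves along its own root and the others move in the span of the
  remaining roots. If the total displacement is zero, independence makes both parts vanish.
\<close>
lemma independent_foldr_reflect_fixed:
  assumes "distinct \<beta>s" "independent (set \<beta>s)" "foldr reflect \<beta>s u = u" "\<beta> \<in> set \<beta>s"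
  shows "B u \<beta> = 0"
  using assms
proof (induction \<beta>s arbitrary: \<beta>)
  case (Cons \<gamma> \<gamma>s)
  define u' where "u' = foldr reflect \<gamma>s u"
  have eq: "u = u' - B u' \<gamma> *\<^sub>R \<gamma>"
    using Cons.prems(3) by (simp add: u'_def reflect_def[of \<gamma>])
  have "- (u - u') \<in> span (set \<gamma>s)"
    unfolding u'_def by (rule span_neg[OF foldr_reflect_moves_in_span])
  moreover have "- (u - u') = B u' \<gamma> *\<^sub>R \<gamma>"
    using eq by (metis add_diff_cancel_left' diff_add_cancel minus_diff_eq)
  ultimately have in_span: "B u' \<gamma> *\<^sub>R \<gamma> \<in> span (set \<gamma>s)"
    by simp
  have "\<gamma> \<notin> span (set \<gamma>s)"
    using Cons.prems(1,2) independent_insert[of \<gamma> "set \<gamma>s"] by auto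
  then have zero: "B u' \<gamma> = 0"
    using span_scale[OF in_span, of "inverse (B u' \<gamma>)"] by (cases "B u' \<gamma> = 0") auto
  then have "u' = u" using eq by simp
  moreover have "independent (set \<gamma>s)"
    using Cons.prems(2) independent_mono[of "set (\<gamma> # \<gamma>s)" "set \<gamma>s"] by auto
  ultimately have "\<And>\<delta>. \<delta> \<in> set \<gamma>s \<Longrightarrow> B u \<delta> = 0"
    using Cons.IH Cons.prems(1) u'_def by auto
  then show ?case using Cons.prems(4) zero \<open>u' = u\<close> by auto
qed simp

text \<open>
  Write the product as \<open>C = X U\<close>. The displacement \<open>z - C z\<close> is the sum of \<open>z - U z\<close>, in the
  span of \<open>\<gamma>s\<close>, and \<open>U z - X (U z)\<close>, in the span of \<open>\<beta>s\<close>. These spans meet in zero, so a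
  displacement in the span of \<open>\<beta>s\<close> forces \<open>U z = z\<close>.
\<close>
lemma foldr_reflect_agree_on_span:
  assumes "distinct (\<beta>s @ \<gamma>s)" "independent (set (\<beta>s @ \<gamma>s))"
    and "z - foldr reflect (\<beta>s @ \<gamma>s) z \<in> span (set \<beta>s)"
  shows "foldr reflect \<beta>s z = foldr reflect (\<beta>s @ \<gamma>s) z"
proof -
  define z' where "z' = foldr reflect \<gamma>s z"
  have C: "foldr reflect (\<beta>s @ \<gamma>s) z = foldr reflect \<beta>s z'" by (simp add: z'_def)
  have g: "z - z' \<in> span (set \<gamma>s)"
    unfolding z'_def by (rule foldr_reflect_moves_in_span)
  have "z - z' = (z - foldr reflect (\<beta>s @ \<gamma>s) z) - (z' - foldr reflect \<beta>s z')"
    by (simp add: C del: foldr_append)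
  then have b: "z - z' \<in> span (set \<beta>s)"
    using span_diff[OF assms(3) foldr_reflect_moves_in_span[of z' \<beta>s]] by metis
  have "set \<beta>s \<inter> set \<gamma>s = {}" using assms(1) by simp
  then have "z - z' = 0"
    using independent_Un_span_disjoint[of "set \<beta>s" "set \<gamma>s"] assms(2) b g by (metis set_append)
  then have "z = z'" by simp
  then show ?thesis unfolding C by (rule arg_cong)
qed

text \<open>
  Let \<open>X\<close> and \<open>X'\<close> be the two partial products and let \<open>R\<close> be the common span. Given \<open>z\<close>, some \<open>z'\<close>
  has the displacement \<open>z - X z \<in> R\<close> under \<open>C\<close>. Both partial products act like \<open>C\<close> on \<open>z'\<close>. The difference
  \<open>z - z'\<close> is fixed by \<open>X\<close>, hence orthogonal to \<open>R\<close>, hence fixed by \<open>X'\<close>.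
\<close>
lemma foldr_reflect_determined_by_span:
  assumes dist: "distinct (\<beta>s @ \<gamma>s)" "distinct (\<beta>s' @ \<gamma>s')"
    and ind: "independent (set (\<beta>s @ \<gamma>s))" "independent (set (\<beta>s' @ \<gamma>s'))"
    and C: "foldr reflect (\<beta>s @ \<gamma>s) = C" "foldr reflect (\<beta>s' @ \<gamma>s') = C"
    and onto: "\<And>v. v \<in> span (set \<beta>s) \<Longrightarrow> \<exists>z. z - C z = v"
    and span: "span (set \<beta>s) = span (set \<beta>s')"
  shows "foldr reflect \<beta>s = foldr reflect \<beta>s'"
proof
  fix z
  obtain z' where z': "z' - C z' = z - foldr reflect \<beta>s z"
    using onto foldr_reflect_moves_in_span by metis
  have in_span: "z' - C z' \<in> span (set \<beta>s)"
    by (simp add: z' foldr_reflect_moves_in_span)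
  have x: "foldr reflect \<beta>s z' = C z'"
    using foldr_reflect_agree_on_span[OF dist(1) ind(1)] in_span by (simp add: C del: foldr_append)
  have y: "foldr reflect \<beta>s' z' = C z'"
    using foldr_reflect_agree_on_span[OF dist(2) ind(2)] in_span by (simp add: C span del: foldr_append)
  define u where "u = z - z'"
  have fx: "foldr reflect \<beta>s u = u"
    unfolding u_def linear_diff[OF linear_foldr_reflect] x
    using z' by (simp add: algebra_simps)
  have "B u \<beta> = 0" if "\<beta> \<in> set \<beta>s" for \<beta>
    using independent_foldr_reflect_fixed[OF _ _ fx that] dist(1) ind(1)
    by (metis distinct_append independent_mono set_append sup_ge1)
  then have "B u \<beta> = 0" if "\<beta> \<in> set \<beta>s'" for \<beta>
    using orthogonal_span[of "set \<beta>s" u \<beta>] span span_base[OF that] by auto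
  then have "foldr reflect \<beta>s' u = u"
    by (rule foldr_reflect_fixes_orthogonal)
  then show "foldr reflect \<beta>s z = foldr reflect \<beta>s' z"
    using fx x y unfolding u_def linear_diff[OF linear_foldr_reflect] by (metis diff_add_cancel)
qed

lemma independent_dual_family:
  assumes dual: "\<And>\<beta> \<gamma>. \<beta> \<in> X \<Longrightarrow> \<gamma> \<in> X \<Longrightarrow> B (\<omega> \<beta>) \<gamma> = (if \<beta> = \<gamma> then 1 else 0)"
  shows "independent X"
proof
  assume "dependent X"
  then obtain \<beta> where \<beta>: "\<beta> \<in> X" "\<beta> \<in> span (X - {\<beta>})" by (auto simp: dependent_def)
  have "B (\<omega> \<beta>) \<beta> = 0"
    by (rule orthogonal_span[of "X - {\<beta>}"]) (use \<beta> dual in auto)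
  then show False using dual[OF \<beta>(1) \<beta>(1)] by simp
qed

text \<open>
  The displacement has a triangular system of coefficients with respect to the roots, and the
  dual vectors \<open>\<omega> \<beta>\<close> permit solving it one root at a time: adding a multiple of \<open>\<omega> \<beta>\<close> to \<open>z\<close>
  changes the coefficient of the first root \<open>\<beta>\<close> and none of the later ones.
\<close>
lemma foldr_reflect_moves_onto_span:
  assumes "distinct \<beta>s"
    and dual: "\<And>\<beta> \<gamma>. \<beta> \<in> set \<beta>s \<Longrightarrow> \<gamma> \<in> set \<beta>s \<Longrightarrow> B (\<omega> \<beta>) \<gamma> = (if \<beta> = \<gamma> then 1 else 0)"
    and "v \<in> span (set \<beta>s)"
  shows "\<exists>z. z - foldr reflect \<beta>s z = v"
  using assms
proof (induction \<beta>s arbitrary: v)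
  case (Cons \<beta> \<beta>s)
  obtain k where k: "v - k *\<^sub>R \<beta> \<in> span (set \<beta>s)"
    using Cons.prems(3) span_breakdown_eq[of v \<beta> "set \<beta>s"] by auto
  obtain z' where z': "z' - foldr reflect \<beta>s z' = v - k *\<^sub>R \<beta>"
    using Cons.IH[OF _ _ k] Cons.prems(1,2) by auto
  define h where "h = k - B (foldr reflect \<beta>s z') \<beta>"
  define z where "z = z' + h *\<^sub>R \<omega> \<beta>"
  have "foldr reflect \<beta>s (\<omega> \<beta>) = \<omega> \<beta>"
    using Cons.prems by (intro foldr_reflect_fixes_orthogonal) auto
  then have C: "foldr reflect \<beta>s z = foldr reflect \<beta>s z' + h *\<^sub>R \<omega> \<beta>"
    by (simp add: z_def linear_add[OF linear_foldr_reflect] linear_cmul[OF linear_foldr_reflect])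
  then have "B (foldr reflect \<beta>s z) \<beta> = k"
    using Cons.prems(2)[of \<beta> \<beta>] by (simp add: form_simps h_def)
  then have "z - foldr reflect (\<beta> # \<beta>s) z = v"
    using z' C by (simp add: reflect_def[of \<beta>] z_def algebra_simps)
  then show ?case by blast
qed simp

end

section \<open>Dihedral groups\<close>

text \<open>
  Chebyshev polynomials of the second kind \<open>U\<close>, with index and argument shifted:
  \<open>chebyshev d q\<close> is \<open>U\<close> of index \<open>q - 1\<close> at \<open>d / 2\<close>. They are the coefficients of the roots of
  a dihedral group.
\<close>
fun chebyshev :: "real \<Rightarrow> nat \<Rightarrow> real" where
  "chebyshev d 0 = 0"
| "chebyshev d (Suc 0) = 1"
| "chebyshev d (Suc (Suc q)) = d * chebyshev d (Suc q) - chebyshev d q"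

lemma chebyshev_sin: "sin \<theta> * chebyshev (2 * cos \<theta>) q = sin (real q * \<theta>)"
proof (induction "2 * cos \<theta>" q rule: chebyshev.induct)
  case (3 q)
  have "sin (real (Suc (Suc q)) * \<theta>) = sin (real (Suc q) * \<theta> + \<theta>)"
    by (simp add: algebra_simps)
  moreover have "sin (real q * \<theta>) = sin (real (Suc q) * \<theta> - \<theta>)"
    by (simp add: algebra_simps)
  ultimately have "sin (real (Suc (Suc q)) * \<theta>) = 2 * cos \<theta> * sin (real (Suc q) * \<theta>) - sin (real q * \<theta>)"
    unfolding sin_add sin_diff by (simp add: algebra_simps)
  then show ?case using 3 by (simp add: algebra_simps)
qed auto

lemma chebyshev_two: "chebyshev 2 q = real q"
  by (induction "2::real" q rule: chebyshev.induct) auto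

lemma pi_over_nat_bounds:
  assumes "2 \<le> (k::nat)" shows "0 < pi / real k" "pi / real k < pi"
  using assms by (auto simp: field_simps)

text \<open>
  With \<open>\<theta> = pi / k\<close> the value is \<open>sin (q \<theta>) / sin \<theta>\<close>. For \<open>k = 0\<close>, which encodes an infinite
  order, \<open>pi / real k\<close> is \<open>0\<close> and the value is \<open>q\<close>.
\<close>
lemma chebyshev_nonneg:
  assumes "k = 0 \<or> 2 \<le> k \<and> q \<le> k"
  shows "0 \<le> chebyshev (2 * cos (pi / real k)) q"
proof (cases "k = 0")
  case True
  then show ?thesis by (simp add: chebyshev_two)
next
  case False
  then have k: "2 \<le> k" "q \<le> k" using assms by auto
  have "0 < sin (pi / real k)"
    using pi_over_nat_bounds[OF k(1)] by (rule sin_gt_zero)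
  moreover have "0 \<le> sin (real q * (pi / real k))"
    using k by (intro sin_ge_zero) (auto simp: field_simps)
  ultimately show ?thesis
    using chebyshev_sin[of "pi / real k" q] by (metis zero_le_mult_iff not_less_iff_gr_or_eq not_le)
qed

text \<open>
  The last letter is always \<open>t\<close>, and the recursion adds letters in front. This fits
  the action of a word, whose last letter is applied first.
\<close>
fun alternating :: "nat \<Rightarrow> 'a \<Rightarrow> 'a \<Rightarrow> 'a list" where
  "alternating 0 s t = []"
| "alternating (Suc q) s t = (if even q then t else s) # alternating q s t"

lemma length_alternating [simp]: "length (alternating q s t) = q"
  by (induction q) auto

lemma set_alternating: "set (alternating q s t) \<subseteq> {s, t}"
  by (induction q) auto

lemma alternating_Suc_right: "alternating (Suc q) s t = alternating q t s @ [t]"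
  by (induction q) auto

lemma map_alternating: "map f (alternating q s t) = alternating q (f s) (f t)"
  by (induction q) auto

lemma concat_replicate_two: "concat (replicate k [s, t]) = alternating (2 * k) s t"
  by (induction k) auto

context symmetric_form
begin

lemma reflect_self: "B \<alpha> \<alpha> = 2 \<Longrightarrow> reflect \<alpha> (x *\<^sub>R \<alpha>) = - x *\<^sub>R \<alpha>"
  by (simp add: reflect_def form_simps algebra_simps flip: scaleR_add_left)

lemma reflect_combination:
  assumes "B \<beta> \<beta> = 2" "B \<alpha> \<beta> = - d"
  shows "reflect \<beta> (x *\<^sub>R \<alpha> + y *\<^sub>R \<beta>) = x *\<^sub>R \<alpha> + (d * x - y) *\<^sub>R \<beta>"
  using assms by (simp add: reflect_def form_simps algebra_simps flip: scaleR_2)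

lemma foldr_reflect_alternating:
  assumes "B \<alpha> \<alpha> = 2" "B \<beta> \<beta> = 2" "B \<alpha> \<beta> = - d"
  shows "foldr reflect (alternating q \<alpha> \<beta>) \<alpha> =
    (if even q then chebyshev d (Suc q) *\<^sub>R \<alpha> + chebyshev d q *\<^sub>R \<beta>
     else chebyshev d q *\<^sub>R \<alpha> + chebyshev d (Suc q) *\<^sub>R \<beta>)"
proof (induction q)
  case (Suc q)
  have "B \<beta> \<alpha> = - d" using assms(3) form_sym by simp
  then show ?case
    using Suc reflect_combination[of \<beta> \<alpha> d "chebyshev d (Suc q)" "chebyshev d q"]
      reflect_combination[of \<alpha> \<beta> d "chebyshev d (Suc q)" "chebyshev d q"] assms
    by (auto simp: add.commute)
qed simp

text \<open>
  The product fixes \<open>\<alpha>\<close> and \<open>\<beta>\<close> by the Chebyshev formula, since \<open>sin (2 k \<theta>) = 0\<close> for \<open>\<theta> = pi / k\<close>.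
  The Gram determinant \<open>4 (sin \<theta>)\<^sup>2\<close> is nonzero, so every vector is a combination of
  \<open>\<alpha>\<close> and \<open>\<beta>\<close> plus a vector orthogonal to both.
\<close>
lemma dihedral_relation:
  assumes "B \<alpha> \<alpha> = 2" "B \<beta> \<beta> = 2" "B \<alpha> \<beta> = - 2 * cos (pi / real k)" "2 \<le> k"
  shows "foldr reflect (alternating (2 * k) \<alpha> \<beta>) z = z"
proof -
  define \<theta> where "\<theta> = pi / real k"
  define d where "d = 2 * cos \<theta>"
  have d: "B \<alpha> \<beta> = - d" "B \<beta> \<alpha> = - d" using assms(3) form_sym[of \<beta> \<alpha>] by (simp_all add: d_def \<theta>_def)
  have s: "sin \<theta> > 0" unfolding \<theta>_def using pi_over_nat_bounds[OF assms(4)] by (rule sin_gt_zero)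
  have kt: "real k * \<theta> = pi" using assms(4) by (simp add: \<theta>_def)
  let ?g = "foldr reflect (alternating (2 * k) \<alpha> \<beta>)"
  have "sin \<theta> * chebyshev d (2 * k) = 0"
    unfolding d_def chebyshev_sin using kt by (simp add: mult.assoc)
  then have U0: "chebyshev d (2 * k) = 0" using s by simp
  have "real (Suc (2 * k)) * \<theta> = \<theta> + 2 * pi" using kt by (simp add: algebra_simps)
  then have "sin \<theta> * chebyshev d (Suc (2 * k)) = sin \<theta>"
    unfolding d_def chebyshev_sin by (metis sin_periodic)
  then have U1: "chebyshev d (Suc (2 * k)) = 1" using s by simp
  have g\<alpha>: "?g \<alpha> = \<alpha>"
    using foldr_reflect_alternating[OF assms(1,2) d(1), of "2 * k"] U0 U1 by simp
  define j where "j = 2 * (k - 1)"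
  have j: "2 * k = Suc (Suc j)" "even j" using assms(4) by (simp_all add: j_def)
  \<comment> \<open>The reflection applied first sends \<open>\<beta>\<close> to \<open>- \<beta>\<close>. This leaves a word ending in \<open>\<alpha>\<close>, to which
     the Chebyshev formula applies with the roles of \<open>\<alpha>\<close> and \<open>\<beta>\<close> exchanged.\<close>
  have odd_step: "?g \<beta> = - foldr reflect (alternating (Suc j) \<beta> \<alpha>) \<beta>"
  proof -
    have "?g \<beta> = foldr reflect (alternating (Suc j) \<beta> \<alpha>) (reflect \<beta> \<beta>)"
      unfolding j(1) alternating_Suc_right[of "Suc j"] by simp
    also have "reflect \<beta> \<beta> = - \<beta>" using reflect_self[OF assms(2), of 1] by simp
    finally show ?thesis by (simp only: linear_neg[OF linear_foldr_reflect])
  qed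
  have "chebyshev d (Suc j) = -1"
    using U0 U1 unfolding j(1) by simp
  then have g\<beta>: "?g \<beta> = \<beta>"
    using foldr_reflect_alternating[OF assms(2,1) d(2), of "Suc j"] U0 j odd_step by simp
  define D where "D = 4 - d\<^sup>2"
  have "D = 4 * (sin \<theta>)\<^sup>2" by (simp add: D_def d_def power_mult_distrib sin_squared_eq)
  then have D: "D \<noteq> 0" using s by simp
  \<comment> \<open>Cramer's rule for the coefficients of the projection of \<open>z\<close> to the span of \<open>\<alpha>\<close> and \<open>\<beta>\<close>.\<close>
  define p where "p = (2 * B z \<alpha> + d * B z \<beta>) / D"
  define q where "q = (2 * B z \<beta> + d * B z \<alpha>) / D"
  define u where "u = z - (p *\<^sub>R \<alpha> + q *\<^sub>R \<beta>)"
  have pq: "D * p = 2 * B z \<alpha> + d * B z \<beta>" "D * q = 2 * B z \<beta> + d * B z \<alpha>"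
    using D by (simp_all add: p_def q_def)
  have "D * (B z \<alpha> - (p * 2 - q * d)) = 0" "D * (B z \<beta> - (q * 2 - p * d)) = 0"
    using pq unfolding D_def by algebra+
  then have "B u \<alpha> = 0" "B u \<beta> = 0"
    using D assms d by (simp_all add: u_def form_simps)
  then have "?g u = u"
    using set_alternating[of "2 * k" \<alpha> \<beta>] by (intro foldr_reflect_fixes_orthogonal) auto
  moreover have "z = u + p *\<^sub>R \<alpha> + q *\<^sub>R \<beta>" by (simp add: u_def)
  ultimately show ?thesis
    using g\<alpha> g\<beta> by (simp only: linear_add[OF linear_foldr_reflect] linear_cmul[OF linear_foldr_reflect])
qed

end

section \<open>Coxeter groups as presented groups\<close>

context group
begin

lemma list_prod_Nil [simp]: "list_prod G [] = \<one>"
  and list_prod_Cons [simp]: "list_prod G (x # xs) = x \<otimes> list_prod G xs"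
  by (simp_all add: list_prod_def)

lemma list_prod_closed [simp, intro]: "set xs \<subseteq> carrier G \<Longrightarrow> list_prod G xs \<in> carrier G"
  by (induction xs) auto

lemma list_prod_append:
  "set xs \<subseteq> carrier G \<Longrightarrow> set ys \<subseteq> carrier G \<Longrightarrow>
    list_prod G (xs @ ys) = list_prod G xs \<otimes> list_prod G ys"
  by (induction xs) (simp_all add: m_assoc)

end

locale coxeter_group = group W for W :: "('a, 'b) monoid_scheme" (structure) +
  fixes S :: "'a set" and m :: "'a \<Rightarrow> 'a \<Rightarrow> nat"
  assumes finite_generators: "finite S"
    and matrix: "coxeter_matrix S m"
    and presented: "presented_by W S (coxeter_relators S m)"
begin

lemma matrix_diag: "s \<in> S \<Longrightarrow> m s s = 1"
  using matrix by (simp add: coxeter_matrix_def)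

lemma matrix_sym: "s \<in> S \<Longrightarrow> t \<in> S \<Longrightarrow> m s t = m t s"
  using matrix unfolding coxeter_matrix_def by metis

lemma matrix_off_diag: "s \<in> S \<Longrightarrow> t \<in> S \<Longrightarrow> s \<noteq> t \<Longrightarrow> m s t = 0 \<or> 2 \<le> m s t"
  using matrix unfolding coxeter_matrix_def by metis

lemma generators_subset: "S \<subseteq> carrier W"
  and generate_generators: "generate W S = carrier W"
  and eval_word_eq_iff: "u \<in> lists (S \<times> UNIV) \<Longrightarrow> v \<in> lists (S \<times> UNIV) \<Longrightarrow>
    eval_word W u = eval_word W v \<longleftrightarrow> presentation_eq S (coxeter_relators S m) u v"
  using presented by (auto simp: presented_by_def)

lemma generator_closed: "s \<in> S \<Longrightarrow> s \<in> carrier W"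
  using generators_subset by auto

lemma word_closed [simp]: "set ss \<subseteq> S \<Longrightarrow> set ss \<subseteq> carrier W"
  using generators_subset by auto

abbreviation positive_word :: "'a list \<Rightarrow> 'a signed_word" where
  "positive_word ss \<equiv> map (\<lambda>s. (s, True)) ss"

lemma eval_positive_word: "eval_word W (positive_word ss) = list_prod W ss"
  by (induction ss) (simp_all add: eval_word_def)

lemma positive_word_in_lists: "set ss \<subseteq> S \<Longrightarrow> positive_word ss \<in> lists (S \<times> UNIV)"
  by (auto simp: lists_eq_set)

lemma coxeter_relation:
  assumes "s \<in> S" "t \<in> S"
  shows "list_prod W (alternating (2 * m s t) s t) = \<one>"
proof -
  let ?w = "alternating (2 * m s t) s t"
  have w: "positive_word ?w = concat (replicate (m s t) [(s, True), (t, True)])"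
    by (simp add: map_alternating concat_replicate_two)
  have "positive_word ?w \<in> coxeter_relators S m"
    unfolding w coxeter_relators_def using assms by blast
  then have "presentation_eq S (coxeter_relators S m) (positive_word ?w) (positive_word [])"
    using presentation_eq.relator[of "positive_word ?w" "coxeter_relators S m" S "[]" "[]"] by simp
  moreover have "set ?w \<subseteq> S" using set_alternating[of "2 * m s t" s t] assms by auto
  ultimately show ?thesis
    using eval_word_eq_iff[OF positive_word_in_lists positive_word_in_lists, of ?w "[]"]
    by (simp only: eval_positive_word) simp
qed

lemma generator_square: "s \<in> S \<Longrightarrow> s \<otimes> s = \<one>"
  using coxeter_relation[of s s] generator_closed[of s] by (simp add: matrix_diag numeral_2_eq_2)

lemma inv_generator: "s \<in> S \<Longrightarrow> inv s = s"
  using generator_square generator_closed inv_equality by metis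

lemma exists_word:
  assumes "w \<in> carrier W"
  shows "\<exists>ss. set ss \<subseteq> S \<and> list_prod W ss = w"
proof -
  have "w \<in> generate W S" using assms generate_generators by simp
  then show ?thesis
  proof (induction rule: generate.induct)
    case one
    show ?case by (rule exI[of _ "[]"]) simp
  next
    case (incl s)
    then show ?case using generator_closed by (intro exI[of _ "[s]"]) simp
  next
    case (inv s)
    then show ?case using generator_closed inv_generator by (intro exI[of _ "[s]"]) simp
  next
    case (eng g h)
    then obtain ss tt where "set ss \<subseteq> S" "list_prod W ss = g" "set tt \<subseteq> S" "list_prod W tt = h"
      by blast
    then show ?case by (intro exI[of _ "ss @ tt"]) (simp add: list_prod_append)
  qed
qed

text \<open>
  This is the universal property of the presentation, in the form needed to define the
  representation. The generators act by involutions, so the sign of a letter does not affect its action.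
\<close>
lemma word_action_well_defined:
  fixes \<phi> :: "'a \<Rightarrow> 'v \<Rightarrow> 'v"
  assumes inv: "\<And>s z. s \<in> S \<Longrightarrow> \<phi> s (\<phi> s z) = z"
    and rel: "\<And>s t z. s \<in> S \<Longrightarrow> t \<in> S \<Longrightarrow> foldr \<phi> (alternating (2 * m s t) s t) z = z"
    and words: "set ss \<subseteq> S" "set tt \<subseteq> S" "list_prod W ss = list_prod W tt"
  shows "foldr \<phi> ss = foldr \<phi> tt"
proof -
  have act: "foldr (\<lambda>l. \<phi> (fst l)) u = foldr (\<lambda>l. \<phi> (fst l)) v"
    if "presentation_eq S (coxeter_relators S m) u v" for u v :: "'a signed_word"
    using that
  proof (induction rule: presentation_eq.induct)
    case (cancel s u e v)
    then show ?case using inv by (simp add: fun_eq_iff)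
  next
    case (relator r u v)
    then obtain s t where st: "s \<in> S" "t \<in> S" and
      r: "r = alternating (2 * m s t) (s, True) (t, True)"
      unfolding coxeter_relators_def concat_replicate_two by auto
    have "foldr (\<lambda>l. \<phi> (fst l)) r z = foldr \<phi> (map fst r) z" for z
      by (simp add: foldr_map comp_def)
    then have "foldr (\<lambda>l. \<phi> (fst l)) r z = z" for z
      using rel[OF st] by (simp add: r map_alternating)
    then show ?case by (simp add: fun_eq_iff)
  qed auto
  have "presentation_eq S (coxeter_relators S m) (positive_word ss) (positive_word tt)"
    using eval_word_eq_iff[OF positive_word_in_lists positive_word_in_lists, of ss tt] words
    by (simp add: eval_positive_word)
  moreover have "foldr (\<lambda>l. \<phi> (fst l)) (positive_word us) = foldr \<phi> us" for us
    by (simp add: fun_eq_iff foldr_map comp_def)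
  ultimately show ?thesis using act by metis
qed

section \<open>The extended geometric representation\<close>

text \<open>
  The simple roots are normalized to square length \<open>2\<close>, in agreement with \<open>m s s = 1\<close>. Infinite
  order, encoded by \<open>m s t = 0\<close>, gives the usual value \<open>-2\<close> because division by zero yields \<open>0\<close>.
\<close>
definition form_coeff :: "'a \<Rightarrow> 'a \<Rightarrow> real" where
  "form_coeff s t = - 2 * cos (pi / real (m s t))"

lemma form_coeff_diag: "s \<in> S \<Longrightarrow> form_coeff s s = 2"
  by (simp add: form_coeff_def matrix_diag)

lemma form_coeff_sym: "s \<in> S \<Longrightarrow> t \<in> S \<Longrightarrow> form_coeff s t = form_coeff t s"
  by (simp add: form_coeff_def matrix_sym)

text \<open>
  A pair consists of a vector of \<open>V\<close>, in coordinates with respect to the simple roots, and a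
  functional on \<open>V\<close>, given by its values on them. The second sum is the pairing between \<open>V\<close> and
  its dual; it ensures that the simple roots have dual vectors for any Coxeter matrix.
\<close>
definition form :: "('a \<Rightarrow> real) \<times> ('a \<Rightarrow> real) \<Rightarrow> ('a \<Rightarrow> real) \<times> ('a \<Rightarrow> real) \<Rightarrow> real" where
  "form z z' = (\<Sum>s\<in>S. \<Sum>t\<in>S. form_coeff s t * fst z s * fst z' t)
     + (\<Sum>s\<in>S. snd z s * fst z' s + fst z s * snd z' s)"

definition simple_root :: "'a \<Rightarrow> ('a \<Rightarrow> real) \<times> ('a \<Rightarrow> real)" where
  "simple_root s = ((\<lambda>r. if r = s then 1 else 0), 0)"

definition dual_root :: "'a \<Rightarrow> ('a \<Rightarrow> real) \<times> ('a \<Rightarrow> real)" where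
  "dual_root s = (0, (\<lambda>r. if r = s then 1 else 0))"

sublocale symmetric_form form
proof
  fix x y z :: "('a \<Rightarrow> real) \<times> ('a \<Rightarrow> real)" and r :: real
  have "(\<Sum>s\<in>S. \<Sum>t\<in>S. form_coeff s t * fst x s * fst y t) =
      (\<Sum>t\<in>S. \<Sum>s\<in>S. form_coeff t s * fst y t * fst x s)"
    by (subst sum.swap) (auto intro!: sum.cong simp: form_coeff_sym mult_ac)
  then show "form x y = form y x"
    by (simp add: form_def mult_ac add.commute)
  show "form (x + y) z = form x z + form y z"
    by (simp add: form_def algebra_simps sum.distrib)
  show "form (r *\<^sub>R x) z = r * form x z"
    by (simp add: form_def scaleR_fun_def algebra_simps sum_distrib_left)
qed

lemma form_simple_root:
  assumes "t \<in> S"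
  shows "form z (simple_root t) = (\<Sum>s\<in>S. form_coeff s t * fst z s) + snd z t"
  using assms finite_generators
  by (simp add: form_def simple_root_def sum.distrib if_distrib[where f = "(*) x" for x] cong: if_cong)

lemma form_simple_roots: "s \<in> S \<Longrightarrow> t \<in> S \<Longrightarrow> form (simple_root s) (simple_root t) = form_coeff s t"
  using finite_generators by (simp add: form_simple_root) (simp add: simple_root_def if_distrib cong: if_cong)

lemma form_dual_root:
  "t \<in> S \<Longrightarrow> form (dual_root s) (simple_root t) = (if s = t then 1 else 0)"
  by (simp add: form_simple_root) (auto simp: dual_root_def)

definition simple_reflection :: "'a \<Rightarrow> ('a \<Rightarrow> real) \<times> ('a \<Rightarrow> real) \<Rightarrow> ('a \<Rightarrow> real) \<times> ('a \<Rightarrow> real)" where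
  "simple_reflection s = reflect (simple_root s)"

lemma foldr_simple_reflection: "foldr simple_reflection ss = foldr reflect (map simple_root ss)"
  by (induction ss) (simp_all add: simple_reflection_def)

lemma simple_reflection_involution: "s \<in> S \<Longrightarrow> simple_reflection s (simple_reflection s z) = z"
  unfolding simple_reflection_def by (rule reflect_reflect) (simp add: form_simple_roots form_coeff_diag)

lemma simple_reflection_relation:
  assumes "s \<in> S" "t \<in> S"
  shows "foldr simple_reflection (alternating (2 * m s t) s t) z = z"
proof (cases "s = t")
  case True
  then show ?thesis
    using assms by (simp add: matrix_diag numeral_2_eq_2 simple_reflection_involution)
next
  case False
  show ?thesis
  proof (cases "m s t = 0")
    case False
    then show ?thesis
      unfolding foldr_simple_reflection map_alternating
      using assms matrix_off_diag[of s t] \<open>s \<noteq> t\<close>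
      by (intro dihedral_relation) (auto simp: form_simple_roots form_coeff_diag form_coeff_def[of s t])
  qed simp
qed

text \<open>
  Any word for \<open>w\<close> may be chosen, by \<open>word_action_well_defined\<close>.
\<close>
definition action :: "'a \<Rightarrow> ('a \<Rightarrow> real) \<times> ('a \<Rightarrow> real) \<Rightarrow> ('a \<Rightarrow> real) \<times> ('a \<Rightarrow> real)" where
  "action w = foldr simple_reflection (SOME ss. set ss \<subseteq> S \<and> list_prod W ss = w)"

lemma action_list_prod:
  assumes "set ss \<subseteq> S"
  shows "action (list_prod W ss) = foldr simple_reflection ss"
  unfolding action_def
  using someI[of "\<lambda>tt. set tt \<subseteq> S \<and> list_prod W tt = list_prod W ss" ss] assms
  by (intro word_action_well_defined simple_reflection_involution simple_reflection_relation) auto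

lemma action_mult:
  assumes "v \<in> carrier W" "w \<in> carrier W"
  shows "action (v \<otimes> w) z = action v (action w z)"
proof -
  obtain ss tt where ss: "set ss \<subseteq> S" "list_prod W ss = v" and tt: "set tt \<subseteq> S" "list_prod W tt = w"
    using exists_word assms by metis
  then have "v \<otimes> w = list_prod W (ss @ tt)" by (simp add: list_prod_append)
  then show ?thesis
    using ss tt action_list_prod[of "ss @ tt"] action_list_prod by auto
qed

lemma action_one: "action \<one> z = z"
  using action_list_prod[of "[]"] by simp

lemma action_generator: "s \<in> S \<Longrightarrow> action s = simple_reflection s"
  using action_list_prod[of "[s]"] generator_closed[of s] by (simp add: fun_eq_iff)

lemma action_inv: "w \<in> carrier W \<Longrightarrow> action (inv w) (action w z) = z"
  "w \<in> carrier W \<Longrightarrow> action w (action (inv w) z) = z"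
  by (simp_all add: action_one flip: action_mult)

lemma linear_action: "w \<in> carrier W \<Longrightarrow> linear (action w)"
  using exists_word[of w] by (auto simp: action_list_prod foldr_simple_reflection linear_foldr_reflect)

lemma form_action_action:
  assumes "w \<in> carrier W"
  shows "form (action w x) (action w y) = form x y"
proof -
  obtain ss where ss: "set ss \<subseteq> S" "list_prod W ss = w" using exists_word assms by blast
  have "form (foldr simple_reflection ss x) (foldr simple_reflection ss y) = form x y"
    using ss(1)
    by (induction ss)
      (simp_all add: simple_reflection_def form_reflect_reflect form_simple_roots form_coeff_diag)
  then show ?thesis using action_list_prod[OF ss(1)] ss(2) by simp
qed

lemma action_conjugate:
  assumes "w \<in> carrier W" "s \<in> S"
  shows "action (w \<otimes> s \<otimes> inv w) = reflect (action w (simple_root s))"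
proof
  fix z
  let ?y = "action (inv w) z"
  have "action (w \<otimes> s \<otimes> inv w) z = action w (reflect (simple_root s) ?y)"
    using assms generator_closed by (simp add: action_mult action_generator simple_reflection_def)
  also have "\<dots> = action w ?y - form ?y (simple_root s) *\<^sub>R action w (simple_root s)"
    by (simp add: reflect_def linear_diff[OF linear_action] linear_cmul[OF linear_action] assms)
  also have "form ?y (simple_root s) = form z (action w (simple_root s))"
    using form_action_action[OF assms(1), of ?y "simple_root s"] by (simp add: action_inv assms)
  finally show "action (w \<otimes> s \<otimes> inv w) z = reflect (action w (simple_root s)) z"
    by (simp add: reflect_def action_inv assms)
qed

section \<open>Faithfulness of the representation\<close>

definition word_length :: "'a \<Rightarrow> nat" where
  "word_length w = (LEAST k. \<exists>ss. set ss \<subseteq> S \<and> length ss = k \<and> list_prod W ss = w)"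

lemma word_length_le: "set ss \<subseteq> S \<Longrightarrow> word_length (list_prod W ss) \<le> length ss"
  unfolding word_length_def by (rule Least_le) blast

lemma exists_reduced_word:
  assumes "w \<in> carrier W"
  shows "\<exists>ss. set ss \<subseteq> S \<and> length ss = word_length w \<and> list_prod W ss = w"
  unfolding word_length_def by (rule LeastI_ex) (use exists_word[OF assms] in blast)

lemma word_length_mult_word_le:
  assumes "v \<in> carrier W" "set ss \<subseteq> S"
  shows "word_length (v \<otimes> list_prod W ss) \<le> word_length v + length ss"
proof -
  obtain tt where tt: "set tt \<subseteq> S" "length tt = word_length v" "list_prod W tt = v"
    using exists_reduced_word assms(1) by blast
  then have "v \<otimes> list_prod W ss = list_prod W (tt @ ss)"
    using assms(2) by (simp add: list_prod_append)
  then show ?thesis using word_length_le[of "tt @ ss"] tt assms(2) by simp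
qed

lemma mult_generator_twice: "s \<in> S \<Longrightarrow> v \<in> carrier W \<Longrightarrow> v \<otimes> s \<otimes> s = v"
  by (simp add: m_assoc generator_closed generator_square)

text \<open>
  Splitting off the last letters of both words leaves the quotient for \<open>k\<close> with \<open>s\<close> and \<open>t\<close>
  exchanged, framed by \<open>s\<close> on the left and \<open>t\<close> on the right.
\<close>
lemma alternating_quotient:
  assumes "s \<in> S" "t \<in> S"
  shows "inv (list_prod W (alternating k t s)) \<otimes> list_prod W (alternating k s t) =
    list_prod W (alternating (2 * k) s t)"
  using assms
proof (induction k arbitrary: s t)
  case (Suc k)
  have sub: "set (alternating j s t) \<subseteq> carrier W" "set (alternating j t s) \<subseteq> carrier W" for j
    using set_alternating[of j s t] set_alternating[of j t s] Suc.prems generator_closed by auto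
  define p where "p = list_prod W (alternating k s t)"
  define q where "q = list_prod W (alternating k t s)"
  have [simp]: "p \<in> carrier W" "q \<in> carrier W" "s \<in> carrier W" "t \<in> carrier W"
    using sub Suc.prems generator_closed by (auto simp: p_def q_def)
  have "list_prod W (alternating (Suc k) s t) = q \<otimes> t" "list_prod W (alternating (Suc k) t s) = p \<otimes> s"
    unfolding alternating_Suc_right using sub by (simp_all add: list_prod_append p_def q_def)
  then have "inv (list_prod W (alternating (Suc k) t s)) \<otimes> list_prod W (alternating (Suc k) s t) =
      s \<otimes> ((inv p \<otimes> q) \<otimes> t)"
    using Suc.prems by (simp add: inv_mult_group inv_generator m_assoc)
  also have "inv p \<otimes> q = list_prod W (alternating (2 * k) t s)"
    unfolding p_def q_def using Suc.IH[OF Suc.prems(2,1)] .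
  also have "alternating (2 * Suc k) s t = s # (alternating (2 * k) t s @ [t])"
    using alternating_Suc_right[of "2 * k" s t] by simp
  then have "s \<otimes> (list_prod W (alternating (2 * k) t s) \<otimes> t) = list_prod W (alternating (2 * Suc k) s t)"
    using sub by (simp add: list_prod_append)
  finally show ?case .
qed simp

lemma braid_relation:
  assumes "s \<in> S" "t \<in> S"
  shows "list_prod W (alternating (m s t) s t) = list_prod W (alternating (m s t) t s)"
proof -
  have sub: "set (alternating j s t) \<subseteq> carrier W" "set (alternating j t s) \<subseteq> carrier W" for j
    using set_alternating[of j s t] set_alternating[of j t s] assms generator_closed by auto
  define p where "p = list_prod W (alternating (m s t) s t)"
  define q where "q = list_prod W (alternating (m s t) t s)"
  have "p \<in> carrier W" "q \<in> carrier W" using sub by (auto simp: p_def q_def)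
  moreover have "inv q \<otimes> p = \<one>"
    unfolding p_def q_def alternating_quotient[OF assms] by (rule coxeter_relation[OF assms])
  ultimately have "p = q" by (metis inv_equality inv_inv inv_closed)
  then show ?thesis unfolding p_def q_def .
qed

text \<open>
  The condition is imposed on the coordinates with respect to the simple roots. It is used for
  roots, which have no component in the dual space.
\<close>
definition nonneg :: "('a \<Rightarrow> real) \<times> ('a \<Rightarrow> real) \<Rightarrow> bool" where
  "nonneg z \<longleftrightarrow> (\<forall>r. 0 \<le> fst z r)"

lemma nonneg_add: "nonneg x \<Longrightarrow> nonneg y \<Longrightarrow> nonneg (x + y)"
  by (simp add: nonneg_def)

lemma nonneg_scaleR: "0 \<le> k \<Longrightarrow> nonneg x \<Longrightarrow> nonneg (k *\<^sub>R x)"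
  by (simp add: nonneg_def scaleR_fun_def)

lemma nonneg_simple_root: "nonneg (simple_root s)"
  by (simp add: nonneg_def simple_root_def)

text \<open>
  If \<open>s\<close> is not a descent of \<open>w\<close>, then \<open>w\<close> sends the simple root of \<open>s\<close> to a nonnegative
  combination of simple roots. For the induction, let \<open>t\<close> be the last letter of a reduced word of
  \<open>w\<close>, and split off from \<open>w\<close> an alternating word in \<open>s\<close> and \<open>t\<close>, ending in \<open>t\<close>, of maximal length \<open>q\<close> such that
  \<open>w = v \<cdot> (\<dots> s t)\<close> with lengths adding up. Then neither letter is a descent of the
  shorter element \<open>v\<close>: one of them by maximality of \<open>q\<close>, the other by additivity of the lengths. If \<open>q\<close> reached \<open>m s t\<close>, the braid relation would rewrite \<open>w\<close> as a reduced word ending in \<open>s\<close>.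
  So \<open>q < m s t\<close>, the alternating word takes the root of \<open>s\<close> to a nonnegative combination
  of the roots of \<open>s\<close> and \<open>t\<close>, and the induction hypothesis for \<open>v\<close> applies to both.
\<close>
lemma nonneg_root:
  assumes "w \<in> carrier W" "s \<in> S" "word_length w \<le> word_length (w \<otimes> s)"
  shows "nonneg (action w (simple_root s))"
  using assms
proof (induction "word_length w" arbitrary: w s rule: less_induct)
  case less
  note s = \<open>s \<in> S\<close> and w = \<open>w \<in> carrier W\<close>
  obtain ss where ss: "set ss \<subseteq> S" "length ss = word_length w" "list_prod W ss = w"
    using exists_reduced_word[OF w] by blast
  show ?case
  proof (cases ss rule: rev_cases)
    case Nil
    then have "w = \<one>" using ss(3) by simp
    then show ?thesis by (simp add: action_one nonneg_simple_root)
  next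
    case (snoc ss' t)
    have t: "t \<in> S" and ss': "set ss' \<subseteq> S" using ss snoc by auto
    define v0 where "v0 = list_prod W ss'"
    have v0: "v0 \<in> carrier W" "w = v0 \<otimes> t" "word_length v0 + 1 \<le> word_length w"
      using ss ss' t generator_closed[of t] word_length_le[OF ss'] snoc
      by (auto simp: v0_def list_prod_append)
    have "s \<noteq> t"
      using v0 less.prems(3) mult_generator_twice[OF t v0(1)] by auto
    have alt: "set (alternating j s t) \<subseteq> S" for j
      using set_alternating[of j s t] s t by auto
    define Q where "Q q \<longleftrightarrow> (\<exists>v \<in> carrier W. w = v \<otimes> list_prod W (alternating q s t)
      \<and> word_length v + q \<le> word_length w)" for q
    have Q1: "Q 1"
      unfolding Q_def using v0 t generator_closed[of t] by (intro bexI[of _ v0]) auto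
    have Q_bound: "q \<le> word_length w" if "Q q" for q
      using that by (auto simp: Q_def)
    define q where "q = (GREATEST q. Q q)"
    have Qq: "Q q"
      unfolding q_def using Q1 Q_bound by (rule GreatestI_nat)
    have q_max: "j \<le> q" if "Q j" for j
      unfolding q_def using that Q_bound by (rule Greatest_le_nat)
    have q_pos: "1 \<le> q" using q_max[OF Q1] .
    \<comment> \<open>Moving the first letter of the alternating word into \<open>v\<close> keeps the lengths additive.\<close>
    have Q_down: "Q j" if Suc_j: "Q (Suc j)" for j
    proof -
      define r where "r = (if even j then t else s)"
      have r: "r \<in> S" using s t by (simp add: r_def)
      obtain v where v: "v \<in> carrier W" "w = v \<otimes> list_prod W (alternating (Suc j) s t)"
        "word_length v + Suc j \<le> word_length w"
        using Suc_j unfolding Q_def by blast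
      have w_eq: "w = v \<otimes> r \<otimes> list_prod W (alternating j s t)"
      proof -
        have "list_prod W (alternating (Suc j) s t) = r \<otimes> list_prod W (alternating j s t)"
          by (simp add: r_def)
        moreover have "v \<otimes> r \<otimes> list_prod W (alternating j s t) = v \<otimes> (r \<otimes> list_prod W (alternating j s t))"
          using v(1) generator_closed[OF r] list_prod_closed[OF word_closed[OF alt]] by (rule m_assoc)
        ultimately show ?thesis using v(2) by (simp only:)
      qed
      have "word_length (v \<otimes> r) \<le> word_length v + 1"
        using word_length_mult_word_le[OF v(1), of "[r]"] r generator_closed by simp
      then have "word_length (v \<otimes> r) + j \<le> word_length w" using v(3) by linarith
      with w_eq have "w = v \<otimes> r \<otimes> list_prod W (alternating j s t)
          \<and> word_length (v \<otimes> r) + j \<le> word_length w" ..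
      moreover have "v \<otimes> r \<in> carrier W" using v(1) generator_closed[OF r] by (rule m_closed)
      ultimately show ?thesis unfolding Q_def by (rule bexI)
    qed
    have bound: "m s t = 0 \<or> 2 \<le> m s t \<and> q < m s t"
    proof (rule ccontr)
      assume "\<not> ?thesis"
      then have k: "2 \<le> m s t" "m s t \<le> q"
        using matrix_off_diag[OF s t \<open>s \<noteq> t\<close>] by auto
      have "Q (m s t)" using k(2) Qq Q_down by (rule inc_induct)
      then obtain v where v: "v \<in> carrier W" "w = v \<otimes> list_prod W (alternating (m s t) t s)"
        "word_length v + m s t \<le> word_length w"
        using braid_relation[OF s t] by (auto simp: Q_def)
      obtain j where j: "m s t = Suc j" using k(1) by (cases "m s t") auto
      have "w = v \<otimes> list_prod W (alternating j s t) \<otimes> s"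
        using v(1,2) alt[of j] s generator_closed unfolding j alternating_Suc_right
        by (simp add: list_prod_append m_assoc)
      then have "w \<otimes> s = v \<otimes> list_prod W (alternating j s t)"
        using mult_generator_twice[OF s] v(1) alt[of j] by auto
      then have "word_length (w \<otimes> s) \<le> word_length v + j"
        using word_length_mult_word_le[OF v(1) alt[of j]] by simp
      then show False using less.prems(3) v(3) j by simp
    qed
    obtain v where v: "v \<in> carrier W" "w = v \<otimes> list_prod W (alternating q s t)"
      "word_length v + q \<le> word_length w"
      using Qq by (auto simp: Q_def)
    \<comment> \<open>The letter \<open>r\<close> would extend the alternating word to the left, and \<open>r'\<close> is its first letter.\<close>
    define r where "r = (if even q then t else s)"
    define r' where "r' = (if even q then s else t)"
    have r: "r \<in> S" "r' \<in> S" "{r, r'} = {s, t}" using s t by (auto simp: r_def r'_def)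
    have "word_length v \<le> word_length (v \<otimes> r)"
    proof (rule ccontr)
      assume "\<not> ?thesis"
      moreover have "w = (v \<otimes> r) \<otimes> list_prod W (alternating (Suc q) s t)"
      proof -
        have "(v \<otimes> r) \<otimes> list_prod W (alternating (Suc q) s t)
            = v \<otimes> r \<otimes> r \<otimes> list_prod W (alternating q s t)"
          using v(1) r(1) generator_closed alt[of q] by (simp add: m_assoc r_def)
        then show ?thesis using v(1,2) mult_generator_twice[OF r(1)] by simp
      qed
      ultimately have "Q (Suc q)" unfolding Q_def
        using v(1,3) r(1) generator_closed by (intro bexI[of _ "v \<otimes> r"]) auto
      then show False using q_max by fastforce
    qed
    moreover have "word_length v \<le> word_length (v \<otimes> r')"
    proof -
      obtain j where j: "q = Suc j" using q_pos by (cases q) auto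
      have "w = (v \<otimes> r') \<otimes> list_prod W (alternating j s t)"
        using v(1,2) r(2) generator_closed alt[of j] by (simp add: j r'_def m_assoc)
      then have "word_length w \<le> word_length (v \<otimes> r') + j"
        using word_length_mult_word_le[of "v \<otimes> r'", OF _ alt[of j]] v(1) r(2) generator_closed by simp
      then show ?thesis using v(3) j by simp
    qed
    moreover have "word_length v < word_length w" using v(3) q_pos by simp
    ultimately have "nonneg (action v (simple_root r))" "nonneg (action v (simple_root r'))"
      using less.hyps v(1) r(1,2) by blast+
    then have nonneg: "nonneg (action v (simple_root s))" "nonneg (action v (simple_root t))"
      using r(3) by (auto simp: doubleton_eq_iff)
    define d where "d = 2 * cos (pi / real (m s t))"
    have "form (simple_root s) (simple_root t) = - d"
      using s t by (simp add: form_simple_roots form_coeff_def d_def)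
    then have "foldr simple_reflection (alternating q s t) (simple_root s) =
      (if even q then chebyshev d (Suc q) *\<^sub>R simple_root s + chebyshev d q *\<^sub>R simple_root t
       else chebyshev d q *\<^sub>R simple_root s + chebyshev d (Suc q) *\<^sub>R simple_root t)"
      unfolding foldr_simple_reflection map_alternating using s t
      by (intro foldr_reflect_alternating) (simp_all add: form_simple_roots form_coeff_diag)
    moreover have "0 \<le> chebyshev d q" "0 \<le> chebyshev d (Suc q)"
      unfolding d_def using bound by (intro chebyshev_nonneg; auto)+
    ultimately obtain x y where xy: "0 \<le> x" "0 \<le> y"
      "foldr simple_reflection (alternating q s t) (simple_root s) = x *\<^sub>R simple_root s + y *\<^sub>R simple_root t"
      by (metis (full_types))
    have "action w (simple_root s) = action v (x *\<^sub>R simple_root s + y *\<^sub>R simple_root t)"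
      using v(1,2) alt[of q] by (simp add: action_mult action_list_prod xy(3))
    also have "\<dots> = x *\<^sub>R action v (simple_root s) + y *\<^sub>R action v (simple_root t)"
      by (simp add: linear_add[OF linear_action] linear_cmul[OF linear_action] v(1))
    finally show ?thesis
      using nonneg xy(1,2) by (simp add: nonneg_add nonneg_scaleR)
  qed
qed

text \<open>
  Let \<open>u \<noteq> \<one>\<close> act trivially and let \<open>s\<close> be a descent of \<open>u\<close>. Then \<open>s\<close> is not a descent of
  \<open>x = u s\<close>, so \<open>x\<close> sends the root of \<open>s\<close> to a nonnegative vector. But \<open>x\<close> acts like \<open>s\<close> and
  negates that root.
\<close>
lemma action_faithful:
  assumes "v \<in> carrier W" "w \<in> carrier W" "action v = action w"
  shows "v = w"
proof -
  define u where "u = inv v \<otimes> w"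
  have u: "u \<in> carrier W" using assms by (simp add: u_def)
  have fixed: "action u z = z" for z
    using assms action_mult[of "inv v" w z] action_inv(1)[of v z] by (simp add: u_def)
  obtain ss where ss: "set ss \<subseteq> S" "length ss = word_length u" "list_prod W ss = u"
    using exists_reduced_word[OF u] by blast
  have "u = \<one>"
  proof (cases ss rule: rev_cases)
    case Nil
    then show ?thesis using ss by simp
  next
    case (snoc ss' s)
    define x where "x = list_prod W ss'"
    have s: "s \<in> S" and x: "x \<in> carrier W" and ux: "u = x \<otimes> s"
      using ss snoc generator_closed by (auto simp: x_def list_prod_append)
    have "word_length x \<le> word_length u"
      using word_length_le[of ss'] ss(1,2) snoc by (simp add: x_def)
    then have "nonneg (action x (simple_root s))"
      using nonneg_root[OF x s] ux by simp
    moreover have "action x (simple_root s) = - simple_root s"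
    proof -
      have "x = u \<otimes> s" using mult_generator_twice[OF s x] ux by simp
      then have "action x (simple_root s) = action s (simple_root s)"
        using u s generator_closed by (simp add: action_mult fixed)
      also have "\<dots> = - simple_root s"
        using reflect_self[of "simple_root s" 1] s
        by (simp add: action_generator simple_reflection_def form_simple_roots form_coeff_diag)
      finally show ?thesis .
    qed
    ultimately have False by (auto simp: nonneg_def simple_root_def dest: spec[of _ s])
    then show ?thesis ..
  qed
  then show ?thesis
    using assms(1,2) unfolding u_def by (metis inv_equality inv_inv inv_closed)
qed

section \<open>Reduced reflection factorizations\<close>

lemma reflections_closed: "t \<in> reflections W S \<Longrightarrow> t \<in> carrier W"
  using generator_closed by (auto simp: reflections_def)

lemma reflections_subset: "set ts \<subseteq> reflections W S \<Longrightarrow> set ts \<subseteq> carrier W"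
  using reflections_closed by auto

lemma generators_are_reflections: "S \<subseteq> reflections W S"
proof
  fix s assume "s \<in> S"
  moreover have "s = \<one> \<otimes> s \<otimes> inv \<one>" using generator_closed[OF \<open>s \<in> S\<close>] by simp
  ultimately show "s \<in> reflections W S" unfolding reflections_def by blast
qed

text \<open>
  The root of a reflection is determined up to sign; either choice gives the same reflection.
\<close>
definition root_of :: "'a \<Rightarrow> ('a \<Rightarrow> real) \<times> ('a \<Rightarrow> real)" where
  "root_of t = (SOME \<beta>. action t = reflect \<beta>)"

lemma action_reflection:
  assumes "t \<in> reflections W S"
  shows "action t = reflect (root_of t)"
proof -
  have "\<exists>\<beta>. action t = reflect \<beta>"
    using assms action_conjugate unfolding reflections_def by blast
  then show ?thesis unfolding root_of_def by (rule someI_ex)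
qed

lemma action_reflection_product:
  "set ts \<subseteq> reflections W S \<Longrightarrow> action (list_prod W ts) = foldr reflect (map root_of ts)"
proof (induction ts)
  case Nil
  then show ?case by (simp add: fun_eq_iff action_one)
next
  case (Cons t ts)
  then show ?case
    using reflections_closed reflections_subset
    by (simp add: fun_eq_iff action_mult action_reflection)
qed

lemma reflection_length_le:
  "set ts \<subseteq> reflections W S \<Longrightarrow> reflection_length W S (list_prod W ts) \<le> length ts"
  unfolding reflection_length_def by (rule Least_le) blast

definition reduced_factorization :: "'a list \<Rightarrow> 'a \<Rightarrow> bool" where
  "reduced_factorization ts w \<longleftrightarrow>
     set ts \<subseteq> reflections W S \<and> length ts = reflection_length W S w \<and> list_prod W ts = w"

lemma exists_reduced_factorization:
  assumes "w \<in> carrier W"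
  shows "\<exists>ts. reduced_factorization ts w"
proof -
  obtain ss where "set ss \<subseteq> S" "list_prod W ss = w" using exists_word[OF assms] by blast
  then have "\<exists>k ts. set ts \<subseteq> reflections W S \<and> length ts = k \<and> list_prod W ts = w"
    using generators_are_reflections by blast
  then show ?thesis
    unfolding reduced_factorization_def reflection_length_def by (rule LeastI_ex)
qed

lemma reduced_factorization_append:
  assumes "absolute_le W S u v" "reduced_factorization ts u" "reduced_factorization us (inv u \<otimes> v)"
  shows "reduced_factorization (ts @ us) v"
proof -
  have "u \<otimes> (inv u \<otimes> v) = v"
    using assms(1) by (simp add: absolute_le_def flip: m_assoc)
  then show ?thesis
    using assms reflections_subset by (auto simp: reduced_factorization_def absolute_le_def list_prod_append)
qed

section \<open>Moved spaces of the elements below a Coxeter element\<close>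

definition moved_space :: "'a \<Rightarrow> (('a \<Rightarrow> real) \<times> ('a \<Rightarrow> real)) set" where
  "moved_space w = range (\<lambda>z. z - action w z)"

lemma moved_space_reflection_product:
  "set ts \<subseteq> reflections W S \<Longrightarrow> moved_space (list_prod W ts) \<subseteq> span (set (map root_of ts))"
  unfolding moved_space_def
  by (simp only: action_reflection_product) (auto intro: foldr_reflect_moves_in_span[of _ "map root_of ts", simplified])

lemma inj_simple_root: "inj simple_root"
  by (rule injI) (auto simp: simple_root_def fun_eq_iff split: if_splits)

lemma simple_root_dual:
  assumes "\<beta> \<in> simple_root ` S" "\<gamma> \<in> simple_root ` S"
  shows "form (dual_root (inv_into UNIV simple_root \<beta>)) \<gamma> = (if \<beta> = \<gamma> then 1 else 0)"
  using assms inj_simple_root by (auto simp: form_dual_root dest: injD)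

lemma independent_simple_roots: "independent (simple_root ` S)"
  using simple_root_dual by (rule independent_dual_family)

text \<open>
  The simple roots, in the order in which \<open>c\<close> multiplies the generators, have dual vectors in the
  summand \<open>V*\<close> of the representation space.
\<close>
lemma moved_space_coxeter_element:
  assumes "coxeter_element W S c"
  shows "span (simple_root ` S) \<subseteq> moved_space c"
proof
  fix v assume v: "v \<in> span (simple_root ` S)"
  obtain cs where cs: "distinct cs" "set cs = S" "list_prod W cs = c"
    using assms by (auto simp: coxeter_element_def)
  have "\<exists>z. z - foldr reflect (map simple_root cs) z = v"
  proof (rule foldr_reflect_moves_onto_span[where \<omega> = "\<lambda>\<beta>. dual_root (inv_into UNIV simple_root \<beta>)"])
    show "distinct (map simple_root cs)"
      using cs(1) inj_on_subset[OF inj_simple_root subset_UNIV] by (simp add: distinct_map)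
  next
    show "v \<in> span (set (map simple_root cs))" using v cs(2) by simp
  qed (rule simple_root_dual; simp add: cs(2))
  then show "v \<in> moved_space c"
    using action_list_prod[of cs] cs by (auto simp: moved_space_def foldr_simple_reflection)
qed

text \<open>
  Such a factorization has at most \<open>card S\<close> factors, because \<open>c\<close> is a product of the generators. Its roots
  span the moved space of \<open>c\<close> and therefore all simple roots.
\<close>
lemma reduced_factorization_coxeter_element:
  assumes c: "coxeter_element W S c" and ts: "reduced_factorization ts c"
  shows "distinct (map root_of ts)" "independent (set (map root_of ts))"
    "span (set (map root_of ts)) \<subseteq> moved_space c"
proof -
  obtain cs where cs: "distinct cs" "set cs = S" "list_prod W cs = c"
    using c by (auto simp: coxeter_element_def)
  have "length ts \<le> card S"
    using reflection_length_le[of cs] generators_are_reflections cs ts distinct_card[of cs]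
    by (simp add: reduced_factorization_def)
  also have "card S = card (simple_root ` S)"
    using inj_simple_root by (metis card_image inj_on_subset subset_UNIV)
  finally have len: "length (map root_of ts) \<le> card (simple_root ` S)" by simp
  have "simple_root ` S \<subseteq> moved_space c"
    using moved_space_coxeter_element[OF c] span_superset by blast
  also have "\<dots> \<subseteq> span (set (map root_of ts))"
    using moved_space_reflection_product[of ts] ts by (simp add: reduced_factorization_def)
  finally have sub: "simple_root ` S \<subseteq> span (set (map root_of ts))" .
  note minimal = spanning_list_of_minimal_length[OF independent_simple_roots sub len]
  show "distinct (map root_of ts)" "independent (set (map root_of ts))" by (fact minimal)+
  show "span (set (map root_of ts)) \<subseteq> moved_space c"
    unfolding minimal(3) by (rule moved_space_coxeter_element[OF c])
qed

text \<open>
  The roots \<open>\<gamma>s\<close> belong to a reduced factorization of \<open>inv x \<otimes> c\<close>.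
\<close>
lemma interval_factorization:
  assumes c: "coxeter_element W S c" and x: "absolute_le W S x c" and ts: "reduced_factorization ts x"
  obtains \<gamma>s where "distinct (map root_of ts @ \<gamma>s)" "independent (set (map root_of ts @ \<gamma>s))"
    "foldr reflect (map root_of ts @ \<gamma>s) = action c"
    "span (set (map root_of ts @ \<gamma>s)) \<subseteq> moved_space c"
proof -
  have "inv x \<otimes> c \<in> carrier W" using x by (simp add: absolute_le_def)
  then obtain us where "reduced_factorization us (inv x \<otimes> c)"
    using exists_reduced_factorization by blast
  then have red: "reduced_factorization (ts @ us) c"
    using reduced_factorization_append[OF x ts] by blast
  then have product: "foldr reflect (map root_of ts @ map root_of us) = action c"
    using action_reflection_product[of "ts @ us"]
    by (simp only: reduced_factorization_def flip: map_append)
  note basis = reduced_factorization_coxeter_element[OF c red, unfolded map_append]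
  show thesis by (rule that[OF basis(1,2) product basis(3)])
qed

text \<open>
  A vector in the span is the displacement of some \<open>z\<close> under \<open>c\<close>, and then \<open>x\<close> displaces \<open>z\<close> in
  the same way.
\<close>
lemma moved_space_interval:
  assumes c: "coxeter_element W S c" and x: "absolute_le W S x c" and ts: "reduced_factorization ts x"
  shows "moved_space x = span (set (map root_of ts))"
proof
  have ts': "set ts \<subseteq> reflections W S" "list_prod W ts = x"
    using ts by (auto simp: reduced_factorization_def)
  then show "moved_space x \<subseteq> span (set (map root_of ts))"
    using moved_space_reflection_product by blast
  obtain \<gamma>s where \<gamma>s: "distinct (map root_of ts @ \<gamma>s)" "independent (set (map root_of ts @ \<gamma>s))"
    "foldr reflect (map root_of ts @ \<gamma>s) = action c"
    "span (set (map root_of ts @ \<gamma>s)) \<subseteq> moved_space c"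
    using interval_factorization[OF assms] .
  show "span (set (map root_of ts)) \<subseteq> moved_space x"
  proof
    fix v assume v: "v \<in> span (set (map root_of ts))"
    then have "v \<in> moved_space c"
      using \<gamma>s(4) span_mono[of "set (map root_of ts)" "set (map root_of ts @ \<gamma>s)"] by auto
    then obtain z where z: "v = z - action c z" by (auto simp: moved_space_def)
    have "foldr reflect (map root_of ts) z = action c z"
      using foldr_reflect_agree_on_span[OF \<gamma>s(1,2), of z] v unfolding \<gamma>s(3) z by blast
    then have "action x z = action c z"
      using action_reflection_product[OF ts'(1)] ts'(2) by simp
    then have "v = z - action x z" using z by simp
    then show "v \<in> moved_space x" unfolding moved_space_def by blast
  qed
qed

text \<open>
  Reduced factorizations of \<open>x\<close> and \<open>y\<close>, each extended to one of \<open>c\<close>, have initial roots with the same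
  span; so \<open>x\<close> and \<open>y\<close> act in the same way, and the representation is faithful.
\<close>
lemma moved_space_injective_on_interval:
  assumes c: "coxeter_element W S c" and x: "absolute_le W S x c" and y: "absolute_le W S y c"
    and eq: "moved_space x = moved_space y"
  shows "x = y"
proof -
  have carrier: "x \<in> carrier W" "y \<in> carrier W" using x y by (auto simp: absolute_le_def)
  obtain ts us where ts: "reduced_factorization ts x" and us: "reduced_factorization us y"
    using exists_reduced_factorization carrier by blast
  obtain \<gamma>s where \<gamma>s: "distinct (map root_of ts @ \<gamma>s)" "independent (set (map root_of ts @ \<gamma>s))"
    "foldr reflect (map root_of ts @ \<gamma>s) = action c"
    "span (set (map root_of ts @ \<gamma>s)) \<subseteq> moved_space c"
    using interval_factorization[OF c x ts] .
  obtain \<delta>s where \<delta>s: "distinct (map root_of us @ \<delta>s)" "independent (set (map root_of us @ \<delta>s))"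
    "foldr reflect (map root_of us @ \<delta>s) = action c"
    using interval_factorization[OF c y us] .
  have "foldr reflect (map root_of ts) = foldr reflect (map root_of us)"
  proof (rule foldr_reflect_determined_by_span[OF \<gamma>s(1) \<delta>s(1) \<gamma>s(2) \<delta>s(2) \<gamma>s(3) \<delta>s(3)])
    fix v assume "v \<in> span (set (map root_of ts))"
    then have "v \<in> moved_space c"
      using \<gamma>s(4) span_mono[of "set (map root_of ts)" "set (map root_of ts @ \<gamma>s)"] by auto
    then show "\<exists>z. z - action c z = v" by (auto simp: moved_space_def)
  next
    show "span (set (map root_of ts)) = span (set (map root_of us))"
      using eq moved_space_interval[OF c x ts] moved_space_interval[OF c y us] by simp
  qed
  then have "action x = action y"
    using ts us action_reflection_product by (metis reduced_factorization_def)
  then show ?thesis using action_faithful carrier by blast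
qed

section \<open>Absence of bowties\<close>

text \<open>
  A reduced factorization of \<open>a\<close> becomes one of \<open>x\<close> when the single reflection \<open>inv a \<otimes> x\<close> is
  appended, and both moved spaces are the spans of the respective roots.
\<close>
lemma moved_space_cover:
  assumes c: "coxeter_element W S c" and a: "absolute_le W S a c" and x: "absolute_le W S x c"
    and ax: "absolute_le W S a x"
    and len: "reflection_length W S x = reflection_length W S a + 1"
  shows "\<exists>\<beta>. moved_space x = span (insert \<beta> (moved_space a))"
proof -
  have carrier: "a \<in> carrier W" "inv a \<otimes> x \<in> carrier W" using ax by (auto simp: absolute_le_def)
  obtain ts us where ts: "reduced_factorization ts a" and us: "reduced_factorization us (inv a \<otimes> x)"
    using exists_reduced_factorization carrier by blast
  have "length us = 1" using us ax len by (simp add: reduced_factorization_def absolute_le_def)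
  then obtain t where t: "us = [t]" by (auto simp: length_Suc_conv)
  have A: "moved_space a = span (set (map root_of ts))"
    by (rule moved_space_interval[OF c a ts])
  have "moved_space x = span (set (map root_of (ts @ us)))"
    by (rule moved_space_interval[OF c x reduced_factorization_append[OF ax ts us]])
  also have "\<dots> = span (insert (root_of t) (set (map root_of ts)))"
    by (simp add: t)
  also have "\<dots> = span (insert (root_of t) (moved_space a))"
    unfolding A span_insert span_span ..
  finally show ?thesis by (rule exI)
qed

lemma span_moved_space:
  assumes "coxeter_element W S c" "absolute_le W S x c"
  shows "span (moved_space x) = moved_space x"
proof -
  have "x \<in> carrier W" using assms(2) by (simp add: absolute_le_def)
  then obtain ts where "reduced_factorization ts x"
    using exists_reduced_factorization by blast
  then show ?thesis
    by (simp only: moved_space_interval[OF assms] span_span)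
qed

lemma moved_space_subset_cover:
  assumes "\<exists>\<beta>. moved_space x = span (insert \<beta> (moved_space a))"
  shows "moved_space a \<subseteq> moved_space x"
proof -
  obtain \<beta> where "moved_space x = span (insert \<beta> (moved_space a))" using assms ..
  then show ?thesis using span_superset[of "insert \<beta> (moved_space a)"] by simp
qed

text \<open>
  The moved space of \<open>x\<close> is larger than that of \<open>a\<close> by one dimension, so it is generated by the
  moved space of \<open>a\<close> and any one vector outside it. Such a vector is found in the moved space of
  \<open>b\<close>, hence also in that of \<open>y\<close>.
\<close>
lemma upper_bounds_moved_space_subset:
  assumes c: "coxeter_element W S c"
    and interval: "absolute_le W S a c" "absolute_le W S b c" "absolute_le W S x c" "absolute_le W S y c"
    and below: "absolute_le W S a x" "absolute_le W S a y" "absolute_le W S b x" "absolute_le W S b y"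
    and len: "reflection_length W S b = reflection_length W S a"
      "reflection_length W S x = reflection_length W S a + 1"
      "reflection_length W S y = reflection_length W S a + 1"
    and not_sub: "\<not> moved_space b \<subseteq> moved_space a"
  shows "moved_space x \<subseteq> moved_space y"
proof -
  obtain v where v: "v \<in> moved_space b" "v \<notin> moved_space a" using not_sub by blast
  have len_b: "reflection_length W S x = reflection_length W S b + 1"
    "reflection_length W S y = reflection_length W S b + 1"
    using len by simp_all
  note cover_x = moved_space_cover[OF c interval(1,3) below(1) len(2)]
  note cover_y = moved_space_cover[OF c interval(1,4) below(2) len(3)]
  obtain \<beta> \<gamma> where \<beta>: "moved_space x = span (insert \<beta> (moved_space a))"
    and \<gamma>: "moved_space y = span (insert \<gamma> (moved_space a))"
    using cover_x cover_y by (elim exE)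
  have a_sub: "moved_space a \<subseteq> moved_space y"
    by (rule moved_space_subset_cover[OF cover_y])
  have "moved_space b \<subseteq> moved_space x" "moved_space b \<subseteq> moved_space y"
    by (rule moved_space_subset_cover[OF moved_space_cover[OF c interval(2,3) below(3) len_b(1)]],
        rule moved_space_subset_cover[OF moved_space_cover[OF c interval(2,4) below(4) len_b(2)]])
  then have v_in: "v \<in> span (insert \<beta> (moved_space a))" "v \<in> moved_space y"
    using v(1) \<beta> by (simp_all only: subset_iff)
  have "v \<notin> span (moved_space a)"
    unfolding span_moved_space[OF c interval(1)] by (rule v(2))
  with v_in(1) have "\<beta> \<in> span (insert v (moved_space a))"
    by (rule in_span_insert)
  moreover have "insert v (moved_space a) \<subseteq> moved_space y"
    using v_in(2) a_sub by (rule insert_subsetI)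
  then have "span (insert v (moved_space a)) \<subseteq> moved_space y"
    unfolding \<gamma> by (rule span_minimal) (rule subspace_span)
  ultimately have "insert \<beta> (moved_space a) \<subseteq> moved_space y"
    using a_sub by blast
  then show ?thesis
    unfolding \<beta> \<gamma> by (rule span_minimal) (rule subspace_span)
qed

lemma no_bowtie:
  assumes c: "coxeter_element W S c"
    and interval: "absolute_le W S a c" "absolute_le W S b c" "absolute_le W S x c" "absolute_le W S y c"
    and below: "absolute_le W S a x" "absolute_le W S a y" "absolute_le W S b x" "absolute_le W S b y"
    and len: "reflection_length W S b = reflection_length W S a"
      "reflection_length W S x = reflection_length W S a + 1"
      "reflection_length W S y = reflection_length W S a + 1"
    and "a \<noteq> b"
  shows "x = y"
proof -
  have "moved_space a \<noteq> moved_space b"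
    using moved_space_injective_on_interval[OF c interval(1,2)] \<open>a \<noteq> b\<close> by blast
  then consider "\<not> moved_space b \<subseteq> moved_space a" | "\<not> moved_space a \<subseteq> moved_space b" by blast
  then have "moved_space x = moved_space y"
  proof cases
    case 1
    then show ?thesis
      using upper_bounds_moved_space_subset[OF c, of a b x y] upper_bounds_moved_space_subset[OF c, of a b y x]
        interval below len by (simp add: subset_antisym)
  next
    case 2
    then show ?thesis
      using upper_bounds_moved_space_subset[OF c, of b a x y] upper_bounds_moved_space_subset[OF c, of b a y x]
        interval below len by (simp add: subset_antisym)
  qed
  then show ?thesis using moved_space_injective_on_interval[OF c interval(3,4)] by blast
qed

end

theorem proposition5p3:
  fixes W :: "('a, 'b) monoid_scheme" and S :: "'a set" and n :: nat and c :: 'a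
  assumes "coxeter_system W S"
    and "finite S"
    and "n = card S"
    and "coxeter_element W S c"
  shows "\<not> (\<exists>a b x y.
    {a, b, x, y} \<subseteq> absolute_interval W S c \<and> distinct [a, b, x, y] \<and>
    (\<exists>k. 1 \<le> k \<and> k + 2 \<le> n \<and>
       reflection_length W S a = k \<and> reflection_length W S b = k \<and>
       reflection_length W S x = k + 1 \<and> reflection_length W S y = k + 1) \<and>
    absolute_le W S a x \<and> absolute_le W S a y \<and>
    absolute_le W S b x \<and> absolute_le W S b y)"
proof -
  obtain m where m: "coxeter_matrix S m" "presented_by W S (coxeter_relators S m)"
    using assms(1) by (auto simp: coxeter_system_def)
  interpret group W using m(2) by (simp add: presented_by_def)
  interpret coxeter_group W S m
    by unfold_locales (use assms(2) m in auto)
  show ?thesis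
  proof (rule notI, elim exE conjE)
    fix a b x y k
    assume "{a, b, x, y} \<subseteq> absolute_interval W S c" and distinct: "distinct [a, b, x, y]"
      and below: "absolute_le W S a x" "absolute_le W S a y" "absolute_le W S b x" "absolute_le W S b y"
      and len: "reflection_length W S a = k" "reflection_length W S b = k"
        "reflection_length W S x = k + 1" "reflection_length W S y = k + 1"
    then have interval: "absolute_le W S a c" "absolute_le W S b c" "absolute_le W S x c" "absolute_le W S y c"
      by (simp_all add: absolute_interval_def)
    have "x = y"
      by (rule no_bowtie[OF assms(4) interval below]) (use len distinct in simp_all)
    then show False using distinct by simp
  qed
qed

end
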